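(* Let $N\ge 3$, $r\ge 1$, let $\mathbf f\in C^{r+1}(U\times V,\mathbb R^N)$ with $U\subset\mathbb R^N$, $V\subset\mathbb R$ open and connected, and suppose that for every $\mu\in V$ the system $\dot{\mathbf x}=\mathbf f(\mathbf x;\mu)$ has a fixed point $\mathbf x_0(\mu)\in U$ depending $C^r$-smoothly on $\mu$. Let $\mathbf A(\mu)=D_{\mathbf x}\mathbf f(\mathbf x_0(\mu),\mu)$ have eigenvalues $\lambda_1(\mu),\dots,\lambda_N(\mu)$ and let $\mu_0\in V$. Assume: (A4) $\lambda_{1,2}(\mu)=\alpha(\mu)\pm i\omega(\mu)$ with $\omega(\mu)\ne 0$ for all $\mu\in V$, $\alpha(\mu_0)=0$, $\alpha(\mu)<0$ for all $\mu<\mu_0$ and $\alpha(\mu)>0$ for all $\mu>\mu_0$; and $\operatorname{Re}\lambda_N(\mu)\le\dots\le\operatorname{Re}\lambda_3(\mu)<0$ for all $\mu\in V$. (A5) $\lambda_3(\mu)=\nu(\mu)$ is real and negative, with $\nu(\mu)<\operatorname{Re}\lambda_{1,2}(\mu)$, for all $\mu\le\mu_0$. (A6) For all $\mu\in V$ the eigenvalues $\lambda_1(\mu),\lambda_2(\mu),\lambda_3(\mu)$ are simple and disjoint from the rest of the spectrum of $\mathbf A(\mu)$. Then the nonresonance conditions $$\nu(\mu)\ne 2m\,\alpha(\mu)\qquad\text{for all } m\in\mathbb N \text{ with } 2\le 2m\le\left\lfloor\frac{\nu(\mu)}{\alpha(\mu)}\right\rfloor+1$$ cannot hold uniformly on any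 open neighborhood of $\mu_0$; that is, for every open neighborhood $V_0\subset V$ of $\mu_0$ there exist $\mu\in V_0$ with $\mu<\mu_0$ and an integer $m$ with $2\le 2m\le\lfloor\nu(\mu)/\alpha(\mu)\rfloor+1$ such that $\nu(\mu)=2m\,\alpha(\mu)$.
   Context: Eigenvalues are listed with multiplicity. The nonresonance condition is meaningful for $\mu<\mu_0$, where $\alpha(\mu)<0$; for $\mu>\mu_0$ the admissible range of $m$ is empty since $\nu(\mu)/\alpha(\mu)<0$. *)

theory Defs
  imports
    "HOL-Analysis.Analysis"
    "HOL-Computational_Algebra.Fundamental_Theorem_Algebra"
begin

text \<open>
  \<open>C_k_on k S f\<close> expresses that \<open>f\<close> is of class \<open>C\<^sup>k\<close> on the open set \<open>S\<close>. Derivatives are taken as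
  full Frechet derivatives; over a finite-dimensional domain the derivative is \<open>C\<^sup>k\<close> as an
  operator-valued map iff each of its directional evaluations is.
\<close>
primrec C_k_on ::
  "nat \<Rightarrow> 'a::euclidean_space set \<Rightarrow> ('a \<Rightarrow> 'b::real_normed_vector) \<Rightarrow> bool" where
  "C_k_on 0 S f \<longleftrightarrow> continuous_on S f"
| "C_k_on (Suc k) S f \<longleftrightarrow>
     (\<forall>x\<in>S. f differentiable at x) \<and>
     (\<forall>v. C_k_on k S (\<lambda>x. frechet_derivative f (at x) v))"

definition charpoly :: "'a::comm_ring_1^'n^'n \<Rightarrow> 'a poly" where
  "charpoly A = det (mat [:0, 1:] - map_matrix (\<lambda>a. [:a:]) A)"

text \<open>The complex eigenvalues of a real matrix, repeated according to algebraic multiplicity.\<close>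
definition eigenvalues :: "real^'n^'n \<Rightarrow> complex multiset" where
  "eigenvalues A = proots (charpoly (map_matrix complex_of_real A))"

end

theory Submission
  imports Defs "HOL-Complex_Analysis.Great_Picard"
begin

text \<open>
  For \<open>\<mu> \<le> \<mu>\<^sub>0\<close> the numbers \<open>\<alpha> \<mu>\<close> and \<open>\<nu> \<mu>\<close> are the first and the third entry in the list of the
  real parts of all eigenvalues in decreasing order, so both are continuous there by the continuity
  of the roots of the characteristic polynomial. For \<open>a < \<mu>\<^sub>0\<close> close to \<open>\<mu>\<^sub>0\<close> and \<open>m\<close> large, the
  function \<open>\<nu> - 2 m \<alpha>\<close> is positive at \<open>a\<close> and negative at \<open>\<mu>\<^sub>0\<close>, and at any of its zeros in between
  the quotient \<open>\<nu> / \<alpha>\<close> is exactly \<open>2 m\<close>.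
\<close>

section \<open>Characteristic polynomials: evaluation, factorization, and a bound for the
  roots\<close>

lemma tendsto_det:
  fixes F :: "'b \<Rightarrow> 'a::real_normed_field^'n^'n"
  assumes "(F \<longlongrightarrow> M) net"
  shows "((\<lambda>x. det (F x)) \<longlongrightarrow> det M) net"
  unfolding det_def by (intro tendsto_intros assms)

lemma poly_det:
  fixes P :: "'a::comm_ring_1 poly^'n^'n"
  shows "poly (det P) z = det (map_matrix (\<lambda>p. poly p z) P)"
proof -
  \<comment> \<open>The signs of the permutations enter the determinant as \<open>of_int\<close>
    constants.\<close>
  have "poly (of_int k) z = of_int k" for k
    by (cases k) auto
  then show ?thesis
    by (simp add: det_def poly_sum poly_prod)
qed

lemma poly_charpoly: "poly (charpoly M) z = det (mat z - M)"
proof -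
  have "map_matrix (\<lambda>p. poly p z) (mat [:0, 1:] - map_matrix (\<lambda>a. [:a:]) M) = mat z - M"
    by (simp add: vec_eq_iff mat_def)
  then show ?thesis
    by (simp add: charpoly_def poly_det)
qed

text \<open>Each row contributes one factor \<open>w\<close>. The left-hand side is the reversed
  characteristic polynomial, whose limit at \<open>w = 0\<close> gives access to the leading
  coefficient.\<close>

lemma det_mat_diff_scale:
  fixes M :: "'a::field^'n^'n"
  assumes "w \<noteq> 0"
  shows "det (mat 1 - map_matrix ((*) w) M) = w ^ CARD('n) * det (mat (1 / w) - M)"
proof -
  have "mat 1 - map_matrix ((*) w) M = (\<chi> i. w *s (mat (1 / w) - M) $ i)"
    using assms by (simp add: vec_eq_iff mat_def algebra_simps)
  then show ?thesis
    using det_rows_mul[of "\<lambda>_. w" "\<lambda>i. (mat (1 / w) - M) $ i"]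
    by (simp only: vec_nth_inverse prod_constant)
qed

text \<open>Over the complex numbers the polynomial splits into linear factors, so only its leading
  coefficient remains to be found.\<close>

lemma poly_charpoly_eq_prod:
  fixes M :: "complex^'n^'n"
  assumes roots: "proots (charpoly M) = image_mset c (mset_set I)"
    and card: "card I = CARD('n)"
  shows "poly (charpoly M) z = (\<Prod>k\<in>I. z - c k)"
proof -
  define lc where "lc = lead_coeff (charpoly M)"
  have fact: "poly (charpoly M) z = lc * (\<Prod>k\<in>I. z - c k)" for z
  proof -
    have "poly (charpoly M) z = poly (smult lc (\<Prod>x\<in>#proots (charpoly M). [:- x, 1:])) z"
      by (simp only: lc_def complex_poly_decompose_multiset)
    also have "(\<Prod>x\<in>#proots (charpoly M). [:- x, 1:]) = (\<Prod>k\<in>I. [:- c k, 1:])"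
      by (simp add: roots prod_unfold_prod_mset image_mset.compositionality o_def)
    finally show ?thesis
      by (simp add: poly_prod)
  qed
  text \<open>Comparing \<open>det (1 - w M)\<close> with \<open>lc * (\<Prod>k\<in>I. 1 - w * c k)\<close> as \<open>w \<rightarrow> 0\<close> shows that the
    characteristic polynomial is monic.\<close>
  have eq: "det (mat 1 - map_matrix ((*) w) M) = lc * (\<Prod>k\<in>I. 1 - w * c k)" if "w \<noteq> 0" for w
  proof -
    \<comment> \<open>By \<open>card\<close>, the power of \<open>w\<close> supplies exactly one
      factor for each root.\<close>
    have "w ^ CARD('n) * (\<Prod>k\<in>I. 1 / w - c k) = (\<Prod>k\<in>I. w * (1 / w - c k))"
      by (simp add: prod.distrib card)
    also have "\<dots> = (\<Prod>k\<in>I. 1 - w * c k)"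
      using that by (simp add: algebra_simps)
    finally show ?thesis
      using that fact[of "1 / w"] by (simp add: det_mat_diff_scale poly_charpoly)
  qed
  have "((\<lambda>w. mat 1 - map_matrix ((*) w) M) \<longlongrightarrow> mat 1) (at 0)"
    by (intro vec_tendstoI) (auto intro!: tendsto_eq_intros)
  then have "((\<lambda>w. det (mat 1 - map_matrix ((*) w) M)) \<longlongrightarrow> 1) (at 0)"
    using tendsto_det by fastforce
  moreover have "((\<lambda>w. lc * (\<Prod>k\<in>I. 1 - w * c k)) \<longlongrightarrow> lc) (at 0)"
    by (auto intro!: tendsto_eq_intros)
  then have "((\<lambda>w. det (mat 1 - map_matrix ((*) w) M)) \<longlongrightarrow> lc) (at 0)"
    by (rule Lim_transform_eventually) (auto simp: eventually_at_filter eq)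
  ultimately have "lc = 1"
    using tendsto_unique trivial_limit_at by blast
  then show ?thesis
    by (simp add: fact)
qed

text \<open>Compare an eigenvector with its image in a component of largest modulus. That row
  depends on the eigenvector, so the bound sums over all rows; what matters is that it is continuous
  in the matrix.\<close>

lemma norm_root_charpoly_le:
  fixes M :: "complex^'n^'n"
  assumes "poly (charpoly M) z = 0"
  shows "norm z \<le> (\<Sum>i\<in>UNIV. \<Sum>j\<in>UNIV. norm (M $ i $ j))"
proof -
  have "\<not> invertible (mat z - M)"
    using assms by (simp add: invertible_det_nz poly_charpoly)
  then obtain v where v: "(mat z - M) *v v = 0" "v \<noteq> 0"
    unfolding invertible_left_inverse matrix_left_invertible_ker by blast
  obtain i where i: "\<And>j. norm (v $ j) \<le> norm (v $ i)"
    using Max_in[of "range (\<lambda>j. norm (v $ j))"] Max_ge[of "range (\<lambda>j. norm (v $ j))"]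
    by (smt (verit) finite_class.finite_UNIV finite_imageI imageE image_is_empty rangeI UNIV_not_empty)
  have pos: "norm (v $ i) > 0"
  proof (rule ccontr)
    assume "\<not> norm (v $ i) > 0"
    then have "v $ j = 0" for j
      using i[of j] by simp
    with v(2) show False
      by (simp add: vec_eq_iff)
  qed
  have "mat z *v v = M *v v"
    using v(1) by (simp add: matrix_vector_mult_diff_rdistrib)
  moreover have "(mat z *v v) $ i = z * v $ i"
    by (simp add: matrix_vector_mult_def mat_def if_distrib[where f="\<lambda>x. x * _"] cong: if_cong)
  ultimately have "z * v $ i = (\<Sum>j\<in>UNIV. M $ i $ j * v $ j)"
    by (simp add: matrix_vector_mult_def)
  then have "norm z * norm (v $ i) = norm (\<Sum>j\<in>UNIV. M $ i $ j * v $ j)"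
    by (metis norm_mult)
  also have "\<dots> \<le> (\<Sum>j\<in>UNIV. norm (M $ i $ j) * norm (v $ i))"
    by (intro sum_norm_le) (simp add: norm_mult mult_left_mono i)
  also have "\<dots> = (\<Sum>j\<in>UNIV. norm (M $ i $ j)) * norm (v $ i)"
    by (simp add: sum_distrib_right)
  finally have "norm z \<le> (\<Sum>j\<in>UNIV. norm (M $ i $ j))"
    using pos by simp
  also have "\<dots> \<le> (\<Sum>i\<in>UNIV. \<Sum>j\<in>UNIV. norm (M $ i $ j))"
    by (rule member_le_sum[of i UNIV "\<lambda>i. \<Sum>j\<in>UNIV. norm (M $ i $ j)"]) (auto intro: sum_nonneg)
  finally show ?thesis .
qed

section \<open>Ordered listings of roots and continuity of their real parts\<close>

text \<open>A finite multiset in a linear order has only one decreasing listing. The lists are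
  reversed in order to use the uniqueness of increasing ones.\<close>

lemma antimono_on_eqI:
  fixes f g :: "nat \<Rightarrow> 'a::linorder"
  assumes eq: "image_mset f (mset_set {m..n}) = image_mset g (mset_set {m..n})"
    and "antimono_on {m..n} f" "antimono_on {m..n} g" "k \<in> {m..n}"
  shows "f k = g k"
proof -
  have sorted: "sorted (rev (map h [m..<Suc n]))" if "antimono_on {m..n} h" for h :: "nat \<Rightarrow> 'a"
    using that unfolding sorted_wrt_rev sorted_wrt_map unfolding sorted_wrt_iff_nth_less
    by (auto simp: monotone_on_def simp del: upt_Suc)
  have "mset (map f [m..<Suc n]) = mset (map g [m..<Suc n])"
    using eq by (simp add: atLeastLessThanSuc_atLeastAtMost del: upt_Suc)
  then have "rev (map f [m..<Suc n]) = rev (map g [m..<Suc n])"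
    using sorted assms(2,3) by (metis mset_rev properties_for_sort)
  then have "map f [m..<Suc n] = map g [m..<Suc n]"
    by (simp only: rev_is_rev_conv)
  then show ?thesis
    using assms(4) by (auto simp: map_eq_conv simp del: upt_Suc)
qed

text \<open>In characteristic zero, polynomials that agree as functions are equal, hence have the
  same roots with multiplicity.\<close>

lemma image_mset_eqI_prod:
  fixes c d :: "'i \<Rightarrow> 'a::{idom, ring_char_0}"
  assumes "finite I" and "\<And>z. (\<Prod>k\<in>I. z - c k) = (\<Prod>k\<in>I. z - d k)"
  shows "image_mset c (mset_set I) = image_mset d (mset_set I)"
proof -
  have roots: "proots (\<Prod>k\<in>I. [:- e k, 1:]) = image_mset e (mset_set I)" for e :: "'i \<Rightarrow> 'a"
    by (subst proots_prod) (simp_all add: sum_unfold_sum_mset)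
  have "(\<Prod>k\<in>I. [:- c k, 1:]) = (\<Prod>k\<in>I. [:- d k, 1:])"
    by (subst poly_eq_poly_eq_iff[symmetric]) (simp add: fun_eq_iff poly_prod assms)
  then show ?thesis
    using roots by metis
qed

text \<open>Every sequence of ordered root vectors is bounded, and each of its limit points is again an
  ordered root vector of the limit matrix; its real parts are therefore determined.\<close>

lemma continuous_on_Re_ordered_eigenvalue:
  fixes A :: "'a::metric_space \<Rightarrow> complex^'n^'n" and c :: "nat \<Rightarrow> 'a \<Rightarrow> complex"
  assumes cont: "continuous_on S A"
    and roots: "\<And>x. x \<in> S \<Longrightarrow> proots (charpoly (A x)) = image_mset (\<lambda>k. c k x) (mset_set {1..CARD('n)})"
    and ordered: "\<And>x. x \<in> S \<Longrightarrow> antimono_on {1..CARD('n)} (\<lambda>k. Re (c k x))"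
    and k: "k \<in> {1..CARD('n)}"
  shows "continuous_on S (\<lambda>x. Re (c k x))"
proof (rule ccontr)
  let ?I = "{1..CARD('n)}"
  assume "\<not> continuous_on S (\<lambda>x. Re (c k x))"
  then obtain x e where x: "x \<in> S" and e: "e > 0"
    and ex: "\<And>d. d > 0 \<Longrightarrow> \<exists>y\<in>S. dist y x < d \<and> \<not> dist (Re (c k y)) (Re (c k x)) < e"
    unfolding continuous_on_iff by metis
  have "\<exists>y. \<forall>n. y n \<in> S \<and> dist (y n) x < inverse (real (Suc n)) \<and> \<not> dist (Re (c k (y n))) (Re (c k x)) < e"
    by (intro choice allI) (metis ex inverse_positive_iff_positive of_nat_0_less_iff zero_less_Suc)
  then obtain y where yS: "\<And>n. y n \<in> S" and yx: "\<And>n. dist (y n) x < inverse (real (Suc n))"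
    and far: "\<And>n. \<not> dist (Re (c k (y n))) (Re (c k x)) < e"
    by blast
  have "(\<lambda>n. dist (y n) x) \<longlonglongrightarrow> 0"
    by (rule tendsto_sandwich[OF _ _ tendsto_const LIMSEQ_inverse_real_of_nat];
        intro always_eventually allI less_imp_le[OF yx] zero_le_dist)
  then have "y \<longlonglongrightarrow> x"
    using tendsto_dist_iff by blast
  then have Ay: "(\<lambda>n. A (y n)) \<longlonglongrightarrow> A x"
    using cont x yS by (auto intro: continuous_on_tendsto_compose)
  have prod_eq: "det (mat z - A x) = (\<Prod>k\<in>?I. z - c k x)" if "x \<in> S" for x z
    using poly_charpoly_eq_prod[OF roots[OF that], of z] by (simp add: poly_charpoly)
  \<comment> \<open>The root bound converges along the sequence, so a single constant
    \<open>K\<close> bounds all roots of all the matrices.\<close>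
  have "(\<lambda>n. \<Sum>i\<in>UNIV. \<Sum>j\<in>UNIV. norm (A (y n) $ i $ j)) \<longlonglongrightarrow> (\<Sum>i\<in>UNIV. \<Sum>j\<in>UNIV. norm (A x $ i $ j))"
    by (intro tendsto_intros Ay)
  then have "Bseq (\<lambda>n. \<Sum>i\<in>UNIV. \<Sum>j\<in>UNIV. norm (A (y n) $ i $ j))"
    using convergentI convergent_imp_Bseq by blast
  then obtain K where K: "\<And>n. \<bar>\<Sum>i\<in>UNIV. \<Sum>j\<in>UNIV. norm (A (y n) $ i $ j)\<bar> \<le> K"
    unfolding Bseq_def by auto
  have bound: "norm (c i (y n)) \<le> K" if "i \<in> ?I" for i n
  proof -
    have "poly (charpoly (A (y n))) (c i (y n)) = 0"
      using that by (auto simp: poly_charpoly prod_eq yS)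
    then show ?thesis
      using order_trans[OF norm_root_charpoly_le order_trans[OF abs_ge_self K]] by blast
  qed
  \<comment> \<open>One subsequence serves all finitely many indices at once.\<close>
  obtain s where s: "strict_mono s" and conv: "\<And>i. i \<in> ?I \<Longrightarrow> \<exists>l. (\<lambda>n. c i (y (s n))) \<longlonglongrightarrow> l"
    using function_convergent_subsequence[of ?I "\<lambda>n i. c i (y n)" K] bound by auto
  obtain l where l: "\<And>i. i \<in> ?I \<Longrightarrow> (\<lambda>n. c i (y (s n))) \<longlonglongrightarrow> l i"
    using conv by metis
  have "(\<lambda>n. A (y (s n))) \<longlonglongrightarrow> A x"
    using LIMSEQ_subseq_LIMSEQ[OF Ay s] by (simp add: o_def)
  \<comment> \<open>Both products are the limit of the same characteristic polynomials at
    \<open>z\<close>.\<close>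
  have "(\<Prod>i\<in>?I. z - l i) = (\<Prod>i\<in>?I. z - c i x)" for z
  proof -
    have "(\<lambda>n. det (mat z - A (y (s n)))) \<longlonglongrightarrow> det (mat z - A x)"
      by (intro tendsto_det tendsto_intros) fact
    moreover have "(\<lambda>n. \<Prod>i\<in>?I. z - c i (y (s n))) \<longlonglongrightarrow> (\<Prod>i\<in>?I. z - l i)"
      by (intro tendsto_intros l)
    ultimately show ?thesis
      using LIMSEQ_unique by (auto simp: prod_eq x yS)
  qed
  then have "image_mset l (mset_set ?I) = image_mset (\<lambda>i. c i x) (mset_set ?I)"
    by (intro image_mset_eqI_prod) auto
  \<comment> \<open>Roots with equal real parts may be permuted in the limit, so \<open>l i\<close>
    need not be \<open>c i x\<close>; only the ordered real parts can be matched.\<close>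
  then have "image_mset Re (image_mset l (mset_set ?I)) = image_mset Re (image_mset (\<lambda>i. c i x) (mset_set ?I))"
    by simp
  then have "image_mset (\<lambda>i. Re (l i)) (mset_set ?I) = image_mset (\<lambda>i. Re (c i x)) (mset_set ?I)"
    by (simp add: image_mset.compositionality o_def)
  moreover have "antimono_on ?I (\<lambda>i. Re (l i))"
  proof (rule monotone_onI)
    fix i j assume ij: "i \<in> ?I" "j \<in> ?I" "i \<le> j"
    have "\<forall>n. Re (c j (y (s n))) \<le> Re (c i (y (s n)))"
      using ordered[OF yS] ij by (auto simp: monotone_on_def)
    then show "Re (l j) \<le> Re (l i)"
      using LIMSEQ_le[OF tendsto_Re[OF l[OF ij(2)]] tendsto_Re[OF l[OF ij(1)]]] by blast
  qed
  ultimately have "Re (l k) = Re (c k x)"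
    using antimono_on_eqI[OF _ _ ordered[OF x] k] by blast
  then have "(\<lambda>n. Re (c k (y (s n)))) \<longlonglongrightarrow> Re (c k x)"
    using tendsto_Re[OF l[OF k]] by simp
  \<comment> \<open>Every term of \<open>y\<close> keeps the distance at least \<open>e\<close>, and
    so does the subsequence.\<close>
  from tendstoD[OF this e] show False
    using far by simp
qed

section \<open>Continuity from smoothness, and the partial Jacobian\<close>

lemma C_k_on_Suc_imp_continuous_on: "C_k_on (Suc k) S f \<Longrightarrow> continuous_on S f"
  by (auto intro!: continuous_at_imp_continuous_on differentiable_imp_continuous_within)

lemma C_k_on_imp_continuous_on:
  assumes "C_k_on k S f"
  shows "continuous_on S f"
  using assms C_k_on_Suc_imp_continuous_on by (cases k) (auto simp del: C_k_on.simps(2))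

text \<open>Chain rule along the embedding of \<open>x\<close> as \<open>(x, t)\<close>. It reduces
  the continuity of a matrix entry to that of one directional derivative of \<open>f\<close>, the
  form in which \<open>C_k_on\<close> provides it.\<close>

lemma jacobian_partial_nth:
  fixes f :: "(real^'m) \<times> 'b::real_normed_vector \<Rightarrow> real^'n"
  assumes "f differentiable at (x, t)"
  shows "jacobian (\<lambda>x. f (x, t)) (at x) $ i $ j = frechet_derivative f (at (x, t)) (axis j 1, 0) $ i"
proof -
  have "((\<lambda>x. (x, t)) has_derivative (\<lambda>h. (h, 0))) (at x)"
    by (auto intro!: derivative_eq_intros)
  moreover have "(f has_derivative frechet_derivative f (at (x, t))) (at (x, t))"
    using assms frechet_derivative_works by blast
  ultimately have "((\<lambda>x. f (x, t)) has_derivative (\<lambda>h. frechet_derivative f (at (x, t)) (h, 0))) (at x)"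
    using diff_chain_at[of "\<lambda>x. (x, t)" "\<lambda>h. (h, 0)" x f] by (simp add: o_def)
  from frechet_derivative_at[OF this] show ?thesis
    unfolding jacobian_def by (simp flip: \<open>_ = frechet_derivative _ _\<close> add: matrix_def)
qed

section \<open>Resonances just below the critical parameter\<close>

theorem lemma3p1:
  fixes f :: "(real^'n) \<times> real \<Rightarrow> real^'n"
    and U :: "(real^'n) set" and V :: "real set"
    and r :: nat
    and x\<^sub>0 :: "real \<Rightarrow> real^'n"
    and A :: "real \<Rightarrow> real^'n^'n"
    and lam :: "nat \<Rightarrow> real \<Rightarrow> complex"
    and \<alpha> \<omega> \<nu> :: "real \<Rightarrow> real"
    and \<mu>\<^sub>0 :: real
  assumes dim: "CARD('n) \<ge> 3" and r: "r \<ge> 1"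
    and U: "open U" "connected U" and V: "open V" "connected V"
    and f_smooth: "C_k_on (r + 1) (U \<times> V) f"
    and fixed_point: "\<And>\<mu>. \<mu> \<in> V \<Longrightarrow> x\<^sub>0 \<mu> \<in> U \<and> f (x\<^sub>0 \<mu>, \<mu>) = 0"
    and x0_smooth: "C_k_on r V x\<^sub>0"
    and A: "\<And>\<mu>. \<mu> \<in> V \<Longrightarrow> A \<mu> = jacobian (\<lambda>x. f (x, \<mu>)) (at (x\<^sub>0 \<mu>))"
    and lam: "\<And>\<mu>. \<mu> \<in> V \<Longrightarrow>
                eigenvalues (A \<mu>) = image_mset (\<lambda>k. lam k \<mu>) (mset_set {1..CARD('n)})"
    and mu0: "\<mu>\<^sub>0 \<in> V"
    and A4_pair: "\<And>\<mu>. \<mu> \<in> V \<Longrightarrow>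
                lam 1 \<mu> = Complex (\<alpha> \<mu>) (\<omega> \<mu>) \<and> lam 2 \<mu> = Complex (\<alpha> \<mu>) (- \<omega> \<mu>) \<and> \<omega> \<mu> \<noteq> 0"
    and A4_crossing: "\<alpha> \<mu>\<^sub>0 = 0"
                "\<And>\<mu>. \<mu> \<in> V \<Longrightarrow> \<mu> < \<mu>\<^sub>0 \<Longrightarrow> \<alpha> \<mu> < 0"
                "\<And>\<mu>. \<mu> \<in> V \<Longrightarrow> \<mu> > \<mu>\<^sub>0 \<Longrightarrow> \<alpha> \<mu> > 0"
    and A4_rest: "\<And>\<mu>. \<mu> \<in> V \<Longrightarrow>
                (\<forall>k\<in>{3..<CARD('n)}. Re (lam (k + 1) \<mu>) \<le> Re (lam k \<mu>)) \<and> Re (lam 3 \<mu>) < 0"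
    and A5: "\<And>\<mu>. \<mu> \<in> V \<Longrightarrow> \<mu> \<le> \<mu>\<^sub>0 \<Longrightarrow>
                lam 3 \<mu> = complex_of_real (\<nu> \<mu>) \<and> \<nu> \<mu> < 0 \<and>
                \<nu> \<mu> < Re (lam 1 \<mu>) \<and> \<nu> \<mu> < Re (lam 2 \<mu>)"
    and A6: "\<And>\<mu>. \<mu> \<in> V \<Longrightarrow>
                (\<forall>k\<in>{1, 2, 3}. count (eigenvalues (A \<mu>)) (lam k \<mu>) = 1) \<and>
                {lam 1 \<mu>, lam 2 \<mu>, lam 3 \<mu>} \<inter> (\<lambda>k. lam k \<mu>) ` {4..CARD('n)} = {}"
  shows "\<forall>V\<^sub>0. open V\<^sub>0 \<and> V\<^sub>0 \<subseteq> V \<and> \<mu>\<^sub>0 \<in> V\<^sub>0 \<longrightarrow>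
           (\<exists>\<mu>\<in>V\<^sub>0. \<mu> < \<mu>\<^sub>0 \<and>
             (\<exists>m::int. 2 \<le> 2 * m \<and> 2 * m \<le> \<lfloor>\<nu> \<mu> / \<alpha> \<mu>\<rfloor> + 1 \<and>
                       \<nu> \<mu> = 2 * real_of_int m * \<alpha> \<mu>))"
proof -
  let ?N = "CARD('n)"
  have A_cont: "continuous_on V (\<lambda>\<mu>. map_matrix complex_of_real (A \<mu>))"
  proof -
    have xV: "(x\<^sub>0 \<mu>, \<mu>) \<in> U \<times> V" if "\<mu> \<in> V" for \<mu>
      using that fixed_point by simp
    have x0_cont: "continuous_on V (\<lambda>\<mu>. (x\<^sub>0 \<mu>, \<mu>))"
      using C_k_on_imp_continuous_on[OF x0_smooth] by (intro continuous_intros)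
    have f_diff: "f differentiable at p" and f'_cont: "continuous_on (U \<times> V) (\<lambda>p. frechet_derivative f (at p) v)"
      if "p \<in> U \<times> V" for p v
      using f_smooth that unfolding Suc_eq_plus1[symmetric] C_k_on.simps(2)
      by (blast intro: C_k_on_imp_continuous_on)+
    have "continuous_on V (\<lambda>\<mu>. A \<mu> $ i $ j)" for i j
    proof -
      have "continuous_on V (\<lambda>\<mu>. frechet_derivative f (at (x\<^sub>0 \<mu>, \<mu>)) (axis j 1, 0) $ i)"
        using xV mu0
        by (intro continuous_intros continuous_on_compose2[OF f'_cont x0_cont]) auto
      then show ?thesis
        by (rule continuous_on_eq) (simp add: A jacobian_partial_nth f_diff xV del: mem_Sigma_iff)
    qed
    then show ?thesis
      unfolding map_matrix_def by (intro continuous_on_vec_lambda continuous_on_of_real)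
  qed
  \<comment> \<open>\<open>A5\<close> identifies \<nu> with the third eigenvalue only up to
    \<open>\<mu>\<^sub>0\<close>.\<close>
  define S where "S = {\<mu> \<in> V. \<mu> \<le> \<mu>\<^sub>0}"
  have ordered: "antimono_on {1..?N} (\<lambda>k. Re (lam k \<mu>))" if "\<mu> \<in> S" for \<mu>
  proof -
    have \<mu>: "\<mu> \<in> V" "\<mu> \<le> \<mu>\<^sub>0"
      using that by (auto simp: S_def)
    have step: "Re (lam (Suc k) \<mu>) \<le> Re (lam k \<mu>)" if k: "k \<in> {1..<?N}" for k
    proof -
      \<comment> \<open>The conjugate pair gives equality at \<open>k = 1\<close>, \<open>A5\<close>
        covers \<open>k = 2\<close>, and \<open>A4_rest\<close> the later indices.\<close>
      consider "k = 1" | "k = 2" | "k \<in> {3..<?N}"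
        using k by fastforce
      then show ?thesis
      proof cases
        case 3
        then show ?thesis
          using A4_rest[OF \<mu>(1)] by simp
      qed (use A4_pair[OF \<mu>(1)] A5[OF \<mu>] in \<open>simp_all add: numeral_2_eq_2 numeral_3_eq_3\<close>)
    qed
    have "Re (lam j \<mu>) \<le> Re (lam i \<mu>)" if "i \<le> j" "1 \<le> i" "j \<le> ?N" for i j
      using that by (induction j rule: dec_induct) (auto intro: order_trans[OF step])
    then show ?thesis
      by (auto simp: monotone_on_def)
  qed
  have Re_cont: "continuous_on S (\<lambda>\<mu>. Re (lam k \<mu>))" if "k \<in> {1..?N}" for k
  proof (rule continuous_on_Re_ordered_eigenvalue[OF _ _ ordered that])
    show "continuous_on S (\<lambda>\<mu>. map_matrix complex_of_real (A \<mu>))"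
      using A_cont by (rule continuous_on_subset) (auto simp: S_def)
    show "proots (charpoly (map_matrix complex_of_real (A \<mu>))) = image_mset (\<lambda>k. lam k \<mu>) (mset_set {1..?N})"
      if "\<mu> \<in> S" for \<mu>
      using lam that by (simp add: eigenvalues_def S_def)
  qed
  have \<alpha>_cont: "continuous_on S \<alpha>"
    using A4_pair dim by (intro continuous_on_eq[OF Re_cont[of 1]]) (auto simp: S_def)
  have \<nu>_cont: "continuous_on S \<nu>"
    using A5 dim by (intro continuous_on_eq[OF Re_cont[of 3]]) (auto simp: S_def)
  show ?thesis
  proof (intro allI impI)
    fix V\<^sub>0 assume V0: "open V\<^sub>0 \<and> V\<^sub>0 \<subseteq> V \<and> \<mu>\<^sub>0 \<in> V\<^sub>0"
    then obtain e where e: "e > 0" "cball \<mu>\<^sub>0 e \<subseteq> V\<^sub>0"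
      using open_contains_cball by blast
    \<comment> \<open>The closed ball keeps the whole segment from \<open>a\<close> to
      \<open>\<mu>\<^sub>0\<close>, endpoints included, inside \<open>V\<^sub>0\<close>.\<close>
    define a where "a = \<mu>\<^sub>0 - e"
    have a: "a < \<mu>\<^sub>0" "{a..\<mu>\<^sub>0} \<subseteq> V\<^sub>0"
      using e by (auto simp: a_def cball_eq_atLeastAtMost)
    then have sub: "{a..\<mu>\<^sub>0} \<subseteq> S"
      using V0 by (auto simp: S_def)
    have "a \<in> V"
      using a V0 by (meson atLeastAtMost_iff less_imp_le order_refl subsetD)
    then have "\<alpha> a < 0" "\<nu> a < 0"
      using A4_crossing(2) A5[of a] a(1) by auto
    \<comment> \<open>This \<open>n\<close> becomes the integer \<open>m\<close>. The inequality
      says \<open>n * \<alpha> a < \<nu> a\<close>; doubling the negative left side preserves it, so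
      \<open>?g a\<close> is positive.\<close>
    then obtain n :: nat where n: "- \<nu> a < real n * (- \<alpha> a)"
      using reals_Archimedean3[of "- \<alpha> a"] by (metis neg_0_less_iff_less)
    \<comment> \<open>Positivity gives the lower bound \<open>2 \<le> 2 * m\<close>.\<close>
    with \<open>\<nu> a < 0\<close> have "n > 0"
      by (intro gr0I) auto
    let ?g = "\<lambda>\<mu>. \<nu> \<mu> - 2 * real n * \<alpha> \<mu>"
    have "\<exists>\<mu>\<ge>a. \<mu> \<le> \<mu>\<^sub>0 \<and> ?g \<mu> = 0"
    proof (rule IVT2')
      show "?g \<mu>\<^sub>0 \<le> 0"
        using A5[OF mu0] A4_crossing(1) by simp
      show "0 \<le> ?g a"
        using n \<open>\<nu> a < 0\<close> by simp
      show "continuous_on {a..\<mu>\<^sub>0} ?g"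
        by (intro continuous_intros continuous_on_subset[OF \<alpha>_cont sub] continuous_on_subset[OF \<nu>_cont sub])
    qed (use a in simp)
    then obtain \<mu> where \<mu>: "a \<le> \<mu>" "\<mu> \<le> \<mu>\<^sub>0" "\<nu> \<mu> = 2 * real n * \<alpha> \<mu>"
      by auto
    \<comment> \<open>At \<open>\<mu>\<^sub>0\<close> the resonance would force \<nu> to vanish
      along with \<alpha>.\<close>
    have "\<mu> \<noteq> \<mu>\<^sub>0"
      using A5[OF mu0] A4_crossing(1) \<mu>(3) by auto
    then have "\<mu> < \<mu>\<^sub>0"
      using \<mu> by simp
    moreover have "\<mu> \<in> V\<^sub>0"
      using a \<mu> by auto
    \<comment> \<open>The quotient is an integer, so its floor is \<open>2 * n\<close> itself and
      the upper bound on \<open>2 * m\<close> holds with one to spare.\<close>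
    moreover have "\<nu> \<mu> / \<alpha> \<mu> = of_int (2 * int n)"
      using A4_crossing(2)[of \<mu>] \<open>\<mu> < \<mu>\<^sub>0\<close> \<open>\<mu> \<in> V\<^sub>0\<close> V0 \<mu>(3) by (auto simp: field_simps)
    then have "\<lfloor>\<nu> \<mu> / \<alpha> \<mu>\<rfloor> = 2 * int n"
      by (simp only: floor_of_int)
    ultimately show "\<exists>\<mu>\<in>V\<^sub>0. \<mu> < \<mu>\<^sub>0 \<and> (\<exists>m::int. 2 \<le> 2 * m \<and> 2 * m \<le> \<lfloor>\<nu> \<mu> / \<alpha> \<mu>\<rfloor> + 1 \<and>
        \<nu> \<mu> = 2 * real_of_int m * \<alpha> \<mu>)"
      using \<open>n > 0\<close> \<mu>(3) by (intro bexI[of _ \<mu>] conjI exI[of _ "int n"]) auto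
  qed
qed

end
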